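(* Let $T$ be a semigraceful tree of order $2n+1$. Then the complete multigraph $K_{2n+1}^{(2)}$ (on $2n+1$ vertices, every pair of distinct vertices joined by exactly $2$ edges) can be decomposed into $2n+1$ copies of $T$; that is, its edge multiset can be partitioned into $2n+1$ subgraphs each isomorphic to $T$. Moreover the decomposition can be taken cyclic: identifying the vertices with $\mathbb{Z}_{2n+1}$, the copies are the images of a single copy under the $2n+1$ rotations $x\mapsto x+k$.
   Context: For natural numbers $m,s,t$ define $dc_{m}(s,t)=|s-t|$ if $|s-t|\le m/2$ and $dc_m(s,t)=m-|s-t|$ if $|s-t|\ge m/2$. A tree $T$ of order $2n+1$ is \emph{semigraceful} if its vertices can be labeled bijectively with the numbers $1,\dots,2n+1$ (label $\ell$) so that the multiset of induced edge labels $dc_{2n+1}(\ell(u),\ell(v))$, over the edges $uv$ of $T$, equals $\{1,1,2,2,\dots,n,n\}$. *)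

theory Defs
  imports Main "HOL-Library.Multiset"
begin

record 'a graph =
  verts :: "'a set"
  edges :: "'a set set"

record 'a multigraph =
  mverts :: "'a set"
  medges :: "'a set multiset"

definition simple_graph :: "'a graph \<Rightarrow> bool" where
  "simple_graph G \<longleftrightarrow> finite (verts G) \<and> (\<forall>e \<in> edges G. e \<subseteq> verts G \<and> card e = 2)"

definition is_walk :: "'a graph \<Rightarrow> 'a list \<Rightarrow> bool" where
  "is_walk G p \<longleftrightarrow> p \<noteq> [] \<and> set p \<subseteq> verts G \<and> successively (\<lambda>u v. {u, v} \<in> edges G) p"

definition connected_graph :: "'a graph \<Rightarrow> bool" where
  "connected_graph G \<longleftrightarrow> verts G \<noteq> {} \<and>
     (\<forall>u \<in> verts G. \<forall>v \<in> verts G. \<exists>p. is_walk G p \<and> hd p = u \<and> last p = v)"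

definition is_cycle :: "'a graph \<Rightarrow> 'a list \<Rightarrow> bool" where
  "is_cycle G p \<longleftrightarrow> is_walk G p \<and> distinct p \<and> length p \<ge> 3 \<and> {last p, hd p} \<in> edges G"

definition is_tree :: "'a graph \<Rightarrow> bool" where
  "is_tree G \<longleftrightarrow> simple_graph G \<and> connected_graph G \<and> (\<nexists>p. is_cycle G p)"

definition dc :: "nat \<Rightarrow> nat \<Rightarrow> nat \<Rightarrow> nat" where
  "dc m s t = (let d = nat \<bar>int s - int t\<bar> in if 2 * d \<le> m then d else m - d)"

text \<open>An edge is an unordered pair \<open>{u, v}\<close>; the description below is well defined because
  \<open>dc\<close> is symmetric (see \<open>edge_label_doubleton\<close>).\<close>

definition edge_label :: "nat \<Rightarrow> ('a \<Rightarrow> nat) \<Rightarrow> 'a set \<Rightarrow> nat" where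
  "edge_label m l e = (THE d. \<exists>u v. e = {u, v} \<and> d = dc m (l u) (l v))"

lemma dc_commute: "dc m s t = dc m t s"
  by (simp add: dc_def abs_minus_commute)

lemma edge_label_doubleton: "edge_label m l {u, v} = dc m (l u) (l v)"
  unfolding edge_label_def
  by (rule the_equality) (auto simp: doubleton_eq_iff dc_commute)

definition semigraceful :: "nat \<Rightarrow> 'a graph \<Rightarrow> bool" where
  "semigraceful n T \<longleftrightarrow>
     (\<exists>l. bij_betw l (verts T) {1..2 * n + 1} \<and>
          image_mset (edge_label (2 * n + 1) l) (mset_set (edges T)) = repeat_mset 2 (mset_set {1..n}))"

definition map_graph :: "('a \<Rightarrow> 'b) \<Rightarrow> 'a graph \<Rightarrow> 'b graph" where
  "map_graph f G = \<lparr>verts = f ` verts G, edges = (`) f ` edges G\<rparr>"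

definition isomorphic :: "'a graph \<Rightarrow> 'b graph \<Rightarrow> bool" where
  "isomorphic G H \<longleftrightarrow> (\<exists>f. bij_betw f (verts G) (verts H) \<and> edges H = (`) f ` edges G)"

definition complete_multigraph :: "nat \<Rightarrow> 'a set \<Rightarrow> 'a multigraph" where
  "complete_multigraph r V =
     \<lparr>mverts = V, medges = repeat_mset r (mset_set {e. e \<subseteq> V \<and> card e = 2})\<rparr>"

definition subgraph_of :: "'a graph \<Rightarrow> 'a multigraph \<Rightarrow> bool" where
  "subgraph_of H M \<longleftrightarrow> simple_graph H \<and> verts H \<subseteq> mverts M \<and> mset_set (edges H) \<subseteq># medges M"

definition decomposes_into_copies ::
    "'a multigraph \<Rightarrow> 'i set \<Rightarrow> ('i \<Rightarrow> 'a graph) \<Rightarrow> 'b graph \<Rightarrow> bool" where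
  "decomposes_into_copies M I H T \<longleftrightarrow>
     (\<forall>i \<in> I. subgraph_of (H i) M \<and> isomorphic T (H i)) \<and>
     (\<Sum>i \<in> I. mset_set (edges (H i))) = medges M"

text \<open>The residues modulo \<open>m\<close> are represented by \<open>{..<m}\<close>.\<close>

definition rotate_graph :: "nat \<Rightarrow> nat \<Rightarrow> nat graph \<Rightarrow> nat graph" where
  "rotate_graph m k G = map_graph (\<lambda>x. (x + k) mod m) G"

end

theory Submission
  imports Defs
begin

text \<open>Label the vertices of \<open>T\<close> by \<open>\<int>\<^sub>m\<close> with \<open>m = 2n + 1\<close>. Because \<open>m\<close> is odd, the \<open>m\<close> rotations of
  a single edge of length \<open>d\<close> are pairwise distinct, and they are exactly the pairs at cyclic
  distance \<open>d\<close>. Every length \<open>1, \<dots>, n\<close> occurs on exactly two edges of \<open>T\<close>, so the rotations of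
  \<open>T\<close> cover every pair exactly twice.\<close>

section \<open>Two-element subsets and their images under bijections\<close>

abbreviation pairs :: "'a set \<Rightarrow> 'a set set" where
  "pairs V \<equiv> {e. e \<subseteq> V \<and> card e = 2}"

lemma finite_pairs: "finite V \<Longrightarrow> finite (pairs V)"
  by simp

lemma finite_edges: "simple_graph T \<Longrightarrow> finite (edges T)"
  unfolding simple_graph_def by (rule finite_subset[of _ "Pow (verts T)"]) auto

lemma edges_subset_pairs: "simple_graph T \<Longrightarrow> edges T \<subseteq> pairs (verts T)"
  unfolding simple_graph_def by auto

lemma inj_on_image_pairs: "inj_on f V \<Longrightarrow> inj_on ((`) f) (pairs V)"
  by (rule inj_on_subset[OF inj_on_image_Pow]) auto

lemma image_pairs:
  assumes "bij_betw f V W"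
  shows "(`) f ` pairs V = pairs W"
proof
  have inj: "inj_on f V" and W: "f ` V = W"
    using assms by (auto simp: bij_betw_def)
  show "(`) f ` pairs V \<subseteq> pairs W"
    using W by (auto simp: card_image inj_on_subset[OF inj])
  show "pairs W \<subseteq> (`) f ` pairs V"
  proof
    fix e assume e: "e \<in> pairs W"
    then obtain d where d: "d \<subseteq> V" "e = f ` d"
      using W by (auto simp: subset_image_iff)
    then have "card d = 2"
      using e card_image[OF inj_on_subset[OF inj d(1)]] by simp
    then show "e \<in> (`) f ` pairs V"
      using d by blast
  qed
qed

section \<open>Injective images of a graph as copies inside a complete multigraph\<close>

lemma mset_edges_map_graph:
  assumes "simple_graph T" and "inj_on f (verts T)"
  shows "mset_set (edges (map_graph f T)) = image_mset ((`) f) (mset_set (edges T))"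
proof -
  have "inj_on ((`) f) (edges T)"
    using inj_on_image_pairs[OF assms(2)] edges_subset_pairs[OF assms(1)] inj_on_subset by blast
  then show ?thesis
    by (simp add: map_graph_def image_mset_mset_set)
qed

lemma isomorphic_map_graph: "inj_on f (verts T) \<Longrightarrow> isomorphic T (map_graph f T)"
  unfolding isomorphic_def map_graph_def by (auto simp: bij_betw_def)

text \<open>The edges of the image form a set, so each has multiplicity at most 1, and
  \<open>0 < r\<close> makes every pair of \<open>V\<close> available at least once.\<close>

lemma subgraph_of_map_graph:
  assumes "simple_graph T" and "bij_betw f (verts T) V" and "0 < r"
  shows "subgraph_of (map_graph f T) (complete_multigraph r V)"
proof -
  have fin: "finite V"
    using assms bij_betw_finite unfolding simple_graph_def by blast
  have sub: "edges (map_graph f T) \<subseteq> pairs V"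
    using image_mono[OF edges_subset_pairs[OF assms(1)], of "(`) f"] image_pairs[OF assms(2)]
    by (simp add: map_graph_def)
  have verts: "verts (map_graph f T) = V"
    using assms(2) by (simp add: map_graph_def bij_betw_def)
  have "finite (edges (map_graph f T))"
    using sub fin finite_pairs finite_subset by blast
  then have "mset_set (edges (map_graph f T)) \<subseteq># repeat_mset r (mset_set (pairs V))"
    using sub fin assms(3) by (auto simp: subseteq_mset_def count_mset_set')
  then show ?thesis
    unfolding subgraph_of_def simple_graph_def complete_multigraph_def
    using fin sub verts by auto
qed

text \<open>Reduces a decomposition to one multiset identity: bijections onto \<open>V\<close>
  automatically give isomorphic subgraphs, so only the total edge count remains to be
  checked.\<close>

lemma decomposes_into_copies_map_graph:
  assumes "simple_graph T" and "\<And>i. i \<in> I \<Longrightarrow> bij_betw (f i) (verts T) V" and "0 < r"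
    and "(\<Sum>i\<in>I. image_mset ((`) (f i)) (mset_set (edges T))) = repeat_mset r (mset_set (pairs V))"
  shows "decomposes_into_copies (complete_multigraph r V) I (\<lambda>i. map_graph (f i) T) T"
proof -
  have inj: "inj_on (f i) (verts T)" if "i \<in> I" for i
    using assms(2)[OF that] by (simp add: bij_betw_def)
  have "(\<Sum>i\<in>I. mset_set (edges (map_graph (f i) T))) = repeat_mset r (mset_set (pairs V))"
    unfolding assms(4)[symmetric] by (rule sum.cong) (auto simp: mset_edges_map_graph assms(1) inj)
  then show ?thesis
    unfolding decomposes_into_copies_def
    using subgraph_of_map_graph[OF assms(1,2,3)] isomorphic_map_graph[OF inj]
    by (simp add: complete_multigraph_def)
qed

lemma image_mset_sum: "image_mset h (\<Sum>i\<in>I. f i) = (\<Sum>i\<in>I. image_mset h (f i))"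
  by (induction I rule: infinite_finite_induct) auto

lemma image_mset_repeat_mset: "image_mset h (repeat_mset r A) = repeat_mset r (image_mset h A)"
  by (induction r) auto

section \<open>Rotations and the invariance of cyclic distance\<close>

lemma rotation_eq: "(x::nat) < m \<Longrightarrow> k < m \<Longrightarrow> (x + k) mod m = (if x + k < m then x + k else x + k - m)"
  by (simp add: mod_if)

lemma bij_betw_rotation:
  assumes "k < m"
  shows "bij_betw (\<lambda>x. (x + k) mod m) {..<m} {..<m::nat}"
proof -
  have "inj_on (\<lambda>x. (x + k) mod m) {..<m}"
    using assms by (auto simp: inj_on_def rotation_eq split: if_splits)
  moreover have "(\<lambda>x. (x + k) mod m) ` {..<m} \<subseteq> {..<m}"
    using assms by auto
  ultimately show ?thesis
    by (simp add: bij_betw_def endo_inj_surj)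
qed

lemma dc_le: "a \<le> b \<Longrightarrow> dc m a b = (if 2 * (b - a) \<le> m then b - a else m - (b - a))"
  by (simp add: dc_def Let_def nat_diff_distrib of_nat_diff)

text \<open>If neither or both endpoints wrap around, the difference \<open>b - a\<close> is
  unchanged. If only \<open>b\<close> wraps, the order reverses and the difference becomes
  \<open>m - (b - a)\<close>, which has the same \<open>dc\<close>.\<close>

lemma dc_rotation_le:
  assumes "a < m" "b < m" "k < m" "a \<le> b"
  shows "dc m ((a + k) mod m) ((b + k) mod m) = dc m a b"
proof -
  consider "b + k < m" | "a + k < m" "m \<le> b + k" | "m \<le> a + k"
    using assms by linarith
  then show ?thesis
  proof cases
    case 1 then show ?thesis using assms by (simp add: rotation_eq dc_le)
  next
    case 2
    then have "b + k - m \<le> a + k" using assms by simp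
    with 2 show ?thesis
      using assms by (simp add: rotation_eq dc_le dc_commute[of m "a + k"]) linarith
  next
    case 3 then show ?thesis using assms by (simp add: rotation_eq dc_le)
  qed
qed

lemma dc_rotation:
  assumes "a < m" "b < m" "k < m"
  shows "dc m ((a + k) mod m) ((b + k) mod m) = dc m a b"
  using dc_rotation_le[of a m b k] dc_rotation_le[of b m a k] assms
  by (cases "a \<le> b") (auto simp: dc_commute)

text \<open>A difference d lies between 1 and 2n. It is kept when d \<le> n; otherwise it is
  replaced by 2n + 1 - d, which lies between 1 and n.\<close>

lemma dc_bounds:
  assumes "x < 2 * n + 1" "y < 2 * n + 1" "x \<noteq> y"
  shows "dc (2 * n + 1) x y \<in> {1..n}"
proof -
  have "dc (2 * n + 1) x y \<in> {1..n}" if "x < y" "y < 2 * n + 1" for x y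
    using that by (auto simp: dc_le)
  from this[of x y] this[of y x] show ?thesis
    using assms by (cases x y rule: linorder_cases) (auto simp: dc_commute[of _ y x])
qed

section \<open>Rotation orbits of pairs and the count of rotated edges\<close>

lemma dc_eq_le:
  assumes "a \<le> b" "b < m" "x \<le> y" "y < m" "dc m x y = dc m a b"
  shows "y - x = b - a \<or> y - x = m - (b - a)"
  using assms by (auto simp: dc_le split: if_splits)

text \<open>Equal cyclic distance leaves equal or complementary differences. In the first case
  \<open>a\<close> is rotated to \<open>x\<close> and \<open>b\<close> to \<open>y\<close>; in the
  second the roles cross, \<open>a\<close> going to \<open>y\<close> and \<open>b\<close> to
  \<open>x\<close>.\<close>

lemma rotation_of_dc_eq_le:
  assumes "a \<le> b" "b < m" "x \<le> y" "y < m" "dc m x y = dc m a b"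
  shows "\<exists>k<m. {(a + k) mod m, (b + k) mod m} = {x, y}"
proof -
  \<comment> \<open>Equal differences are split by whether the shift from \<open>a\<close> to
    \<open>x\<close> is nonnegative; if it is not, \<open>m\<close> is added to keep the witness a
    natural number below \<open>m\<close>.\<close>
  consider "y - x = b - a" "a \<le> x" | "y - x = b - a" "x < a" | "y - x = m - (b - a)"
    using dc_eq_le[OF assms] by linarith
  then show ?thesis
  proof cases
    case 1
    then show ?thesis using assms by (intro exI[of _ "x - a"]) auto
  next
    case 2
    then have "a + (x + m - a) = x + m" "b + (x + m - a) = y + m" using assms by auto
    with 2 show ?thesis using assms by (intro exI[of _ "x + m - a"]) auto
  next
    case 3
    then have "a + (y - a) = y" "b + (y - a) = x + m" using assms by auto
    then show ?thesis using assms by (intro exI[of _ "y - a"]) auto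
  qed
qed

lemma rotation_of_dc_eq:
  assumes "a < m" "b < m" "x < m" "y < m" "dc m x y = dc m a b"
  shows "\<exists>k<m. {(a + k) mod m, (b + k) mod m} = {x, y}"
  using assms rotation_of_dc_eq_le[of a b m x y] rotation_of_dc_eq_le[of a b m y x]
    rotation_of_dc_eq_le[of b a m x y] rotation_of_dc_eq_le[of b a m y x]
  by (cases "a \<le> b"; cases "x \<le> y") (auto simp: dc_commute insert_commute)

text \<open>Two rotations could give the same unordered pair with its endpoints exchanged; oddness
  of \<open>m\<close> excludes this. Without an exchange, the image of \<open>a\<close> alone
  determines the shift.\<close>

lemma rotation_pair_inj:
  fixes a b k j m :: nat
  assumes "a < m" "b < m" "a \<noteq> b" "k < m" "j < m" "odd m"
    and "{(a + k) mod m, (b + k) mod m} = {(a + j) mod m, (b + j) mod m}"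
  shows "k = j"
proof -
  have swap: False if "(a + k) mod m = (b + j) mod m" "(b + k) mod m = (a + j) mod m"
  proof -
    \<comment> \<open>Subtracting the two congruences cancels \<open>k\<close> and \<open>j\<close>
      and leaves 2(a - b). Since 2 is invertible modulo \<open>m\<close>, \<open>m\<close> divides a
      - b, which is impossible as 0 < |a - b| < m.\<close>
    have "int m dvd (int a + int k) - (int b + int j)" "int m dvd (int b + int k) - (int a + int j)"
      using that by (metis mod_eq_dvd_iff of_nat_add of_nat_mod)+
    then have "int m dvd ((int a + int k) - (int b + int j)) - ((int b + int k) - (int a + int j))"
      by (rule dvd_diff)
    then have "int m dvd 2 * (int a - int b)"
      by (simp add: algebra_simps)
    moreover have "coprime (int m) 2" using assms(6) by simp
    ultimately have "int m dvd int a - int b"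
      using coprime_dvd_mult_right_iff by blast
    then show False
      using assms(1-3) zdvd_imp_le[of "int m" "\<bar>int a - int b\<bar>"] by auto
  qed
  have "(a + k) mod m = (a + j) mod m"
    using assms(7) swap by (auto simp: doubleton_eq_iff)
  then show ?thesis
    using assms(1,4,5) by (auto simp: rotation_eq split: if_splits)
qed

text \<open>The orbit stays in one label class by invariance of \<open>dc\<close>, exhausts it by
  \<open>rotation_of_dc_eq\<close>, and has no repetitions by \<open>rotation_pair_inj\<close>. The
  labelling is \<open>id\<close> because vertices are now the residues themselves.\<close>

lemma bij_betw_rotations_of_pair:
  fixes n :: nat
  defines "m \<equiv> 2 * n + 1"
  assumes "e \<in> pairs {..<m}"
  shows "bij_betw (\<lambda>k. (\<lambda>x. (x + k) mod m) ` e) {..<m}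
    {p \<in> pairs {..<m}. edge_label m id p = edge_label m id e}"
proof -
  obtain a b where e: "e = {a, b}" and ab: "a < m" "b < m" "a \<noteq> b"
    using assms(2) by (auto simp: card_2_iff)
  have "inj_on (\<lambda>k. (\<lambda>x. (x + k) mod m) ` e) {..<m}"
    using ab rotation_pair_inj[of a m b] unfolding e by (auto intro!: inj_onI simp: m_def)
  moreover have "(\<lambda>x. (x + k) mod m) ` e \<in> pairs {..<m}" if "k < m" for k
    using imageI[OF assms(2), of "(`) (\<lambda>x. (x + k) mod m)"]
    unfolding image_pairs[OF bij_betw_rotation[OF that]] .
  moreover have "edge_label m id ((\<lambda>x. (x + k) mod m) ` e) = edge_label m id e" if "k < m" for k
    using dc_rotation[OF ab(1,2) that] by (simp add: e edge_label_doubleton)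
  moreover have "\<exists>k<m. p = (\<lambda>x. (x + k) mod m) ` e"
    if pair: "p \<in> pairs {..<m}" and label: "edge_label m id p = edge_label m id e" for p
  proof -
    obtain x y where p: "p = {x, y}" "x < m" "y < m"
      using pair by (auto simp: card_2_iff)
    then show ?thesis
      using rotation_of_dc_eq[OF ab(1,2) p(2,3)] label
      by (auto simp: e edge_label_doubleton)
  qed
  ultimately show ?thesis
    unfolding bij_betw_def by blast
qed

text \<open>Each edge contributes its full label class exactly once, so the sum depends on
  \<open>E\<close> only through its multiset of labels. Taking \<open>E\<close> as a multiset lets
  the induction add edges one by one.\<close>

lemma sum_rotations_of_edge_set:
  fixes n :: nat
  defines "m \<equiv> 2 * n + 1"
  assumes "set_mset E \<subseteq> pairs {..<m}"
  shows "(\<Sum>k<m. image_mset ((`) (\<lambda>x. (x + k) mod m)) E)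
    = (\<Sum>d\<in>#image_mset (edge_label m id) E. mset_set {p \<in> pairs {..<m}. edge_label m id p = d})"
  using assms(2)
proof (induction E)
  case empty
  show ?case by simp
next
  case (add e E)
  let ?rot = "\<lambda>k. (\<lambda>x. (x + k) mod m) ` e"
  have bij: "bij_betw ?rot {..<m} {p \<in> pairs {..<m}. edge_label m id p = edge_label m id e}"
    using add.prems bij_betw_rotations_of_pair[of e n] unfolding m_def by simp
  have "(\<Sum>k<m. {#?rot k#}) = image_mset ?rot (mset_set {..<m})"
    by (simp add: sum_unfold_sum_mset)
  also have "\<dots> = mset_set {p \<in> pairs {..<m}. edge_label m id p = edge_label m id e}"
    using bij by (simp add: image_mset_mset_set bij_betw_def)
  finally have orbit: "(\<Sum>k<m. {#?rot k#})
      = mset_set {p \<in> pairs {..<m}. edge_label m id p = edge_label m id e}" .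
  have "(\<Sum>k<m. image_mset ((`) (\<lambda>x. (x + k) mod m)) (add_mset e E))
      = (\<Sum>k<m. {#?rot k#} + image_mset ((`) (\<lambda>x. (x + k) mod m)) E)"
    by simp
  also have "\<dots> = (\<Sum>k<m. {#?rot k#}) + (\<Sum>k<m. image_mset ((`) (\<lambda>x. (x + k) mod m)) E)"
    by (rule sum.distrib)
  finally show ?case
    using add.IH add.prems unfolding orbit by (simp add: id_def)
qed

text \<open>The label classes partition the pairs: by \<open>dc_bounds\<close> each pair lies in
  exactly one class with label in 1, ..., n.\<close>

lemma sum_mset_pairs_by_label:
  fixes n :: nat
  defines "m \<equiv> 2 * n + 1"
  shows "(\<Sum>d\<in>{1..n}. mset_set {p \<in> pairs {..<m}. edge_label m id p = d}) = mset_set (pairs {..<m})"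
proof (rule multiset_eqI)
  fix p :: "nat set"
  have "edge_label m id p \<in> {1..n}" if pair: "p \<in> pairs {..<m}"
  proof -
    obtain x y where "p = {x, y}" "x < m" "y < m" "x \<noteq> y"
      using pair by (auto simp: card_2_iff)
    then show ?thesis
      using dc_bounds[of x n y] unfolding m_def by (simp add: edge_label_doubleton)
  qed
  then show "count (\<Sum>d\<in>{1..n}. mset_set {p \<in> pairs {..<m}. edge_label m id p = d}) p
      = count (mset_set (pairs {..<m})) p"
    by (cases "p \<in> pairs {..<m}") (auto simp: count_sum count_mset_set')
qed

lemma sum_rotations_of_semigraceful:
  fixes n :: nat
  defines "m \<equiv> 2 * n + 1"
  assumes "set_mset E \<subseteq> pairs {..<m}"
    and "image_mset (edge_label m id) E = repeat_mset 2 (mset_set {1..n})"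
  shows "(\<Sum>k<m. image_mset ((`) (\<lambda>x. (x + k) mod m)) E) = repeat_mset 2 (mset_set (pairs {..<m}))"
proof -
  let ?L = "\<lambda>d. mset_set {p \<in> pairs {..<m}. edge_label m id p = d}"
  have "(\<Sum>k<m. image_mset ((`) (\<lambda>x. (x + k) mod m)) E) = (\<Sum>d\<in>#repeat_mset 2 (mset_set {1..n}). ?L d)"
    using sum_rotations_of_edge_set[of E n] assms unfolding m_def by simp
  also have "\<dots> = repeat_mset 2 (\<Sum>d\<in>{1..n}. ?L d)"
    by (simp add: numeral_2_eq_2 sum_unfold_sum_mset)
  finally show ?thesis
    using sum_mset_pairs_by_label[of n] unfolding m_def by simp
qed

section \<open>The cyclic decomposition and its transport to an arbitrary vertex set\<close>

theorem mainTheorem2: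
  fixes n :: nat and T :: "'a graph" and W :: "'b set"
  assumes "is_tree T"
    and "card (verts T) = 2 * n + 1"
    and "semigraceful n T"
    and "card W = 2 * n + 1"
  shows "(\<exists>H. decomposes_into_copies (complete_multigraph 2 W) {..<2 * n + 1} H T)
       \<and> (\<exists>C. subgraph_of C (complete_multigraph 2 {..<2 * n + 1}) \<and> isomorphic T C
              \<and> decomposes_into_copies (complete_multigraph 2 {..<2 * n + 1}) {..<2 * n + 1}
                  (\<lambda>k. rotate_graph (2 * n + 1) k C) T)"
proof -
  define m where "m = 2 * n + 1"
  have T: "simple_graph T"
    using assms(1) by (simp add: is_tree_def)
  obtain l where l: "bij_betw l (verts T) {1..m}"
    and labels: "image_mset (edge_label m l) (mset_set (edges T)) = repeat_mset 2 (mset_set {1..n})"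
    using assms(3) unfolding semigraceful_def m_def by blast
  \<comment> \<open>Labels start at 1 but residues at 0, hence the shift;
    \<open>map_graph g T\<close> serves as the base copy \<open>C\<close>.\<close>
  define g where "g = (\<lambda>v. l v - 1)"
  have "bij_betw (\<lambda>x. x - 1) {1..m} {..<m}"
    by (rule bij_betw_byWitness[of _ Suc]) auto
  then have g: "bij_betw g (verts T) {..<m}"
    using bij_betw_trans[OF l] unfolding g_def comp_def by blast
  define E where "E = image_mset ((`) g) (mset_set (edges T))"
  have E: "set_mset E \<subseteq> pairs {..<m}"
    using image_mono[OF edges_subset_pairs[OF T], of "(`) g"] image_pairs[OF g] finite_edges[OF T]
    by (simp add: E_def)
  \<comment> \<open>The shift preserves differences; truncated subtraction is harmless since all
    labels are at least 1.\<close>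
  have label_g: "edge_label m id (g ` e) = edge_label m l e" if "e \<in> edges T" for e
  proof -
    have "e \<in> pairs (verts T)"
      using edges_subset_pairs[OF T] that by blast
    then obtain u v where e: "e = {u, v}" and uv: "u \<in> verts T" "v \<in> verts T"
      by (auto simp: card_2_iff)
    then have "l u \<ge> 1" "l v \<ge> 1"
      using bij_betwE[OF l] by auto
    then show ?thesis
      by (simp add: e edge_label_doubleton g_def dc_def of_nat_diff)
  qed
  have "image_mset (edge_label m id) E = image_mset (edge_label m l) (mset_set (edges T))"
    unfolding E_def using label_g finite_edges[OF T]
    by (auto simp: multiset.map_comp intro!: image_mset_cong)
  then have sum_E: "(\<Sum>k<m. image_mset ((`) (\<lambda>x. (x + k) mod m)) E) = repeat_mset 2 (mset_set (pairs {..<m}))"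
    using sum_rotations_of_semigraceful[of E n] E labels unfolding m_def by simp
  define f where "f = (\<lambda>k v. (g v + k) mod m)"
  have f: "bij_betw (f k) (verts T) {..<m}" if "k \<in> {..<m}" for k
    using bij_betw_trans[OF g bij_betw_rotation[of k m]] that unfolding f_def comp_def by blast
  have sum_f: "(\<Sum>k<m. image_mset ((`) (f k)) (mset_set (edges T))) = repeat_mset 2 (mset_set (pairs {..<m}))"
    using sum_E unfolding E_def f_def by (simp add: multiset.map_comp comp_def image_image)
  have rot: "rotate_graph m k (map_graph g T) = map_graph (f k) T" for k
    unfolding rotate_graph_def map_graph_def f_def by (simp add: image_image)
  have "subgraph_of (map_graph g T) (complete_multigraph 2 {..<m})"
    using subgraph_of_map_graph[OF T g] by simp
  moreover have "isomorphic T (map_graph g T)"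
    using g isomorphic_map_graph bij_betw_def by blast
  moreover have "decomposes_into_copies (complete_multigraph 2 {..<m}) {..<m}
      (\<lambda>k. rotate_graph m k (map_graph g T)) T"
    unfolding rot using T f sum_f by (intro decomposes_into_copies_map_graph) auto
  moreover have "\<exists>H. decomposes_into_copies (complete_multigraph 2 W) {..<m} H T"
  proof -
    \<comment> \<open>An infinite \<open>W\<close> would have cardinality 0, while \<open>m\<close>
      is positive.\<close>
    have "finite W" "card W = m"
      using assms(4) card.infinite by (force simp: m_def)+
    then obtain h where h: "bij_betw h {..<m} W"
      using ex_bij_betw_nat_finite[of W] by (auto simp: atLeast0LessThan)
    \<comment> \<open>The decomposition on the residues is carried to \<open>W\<close> along
      \<open>h\<close>, which maps pairs bijectively to pairs and so keeps every multiplicity equal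
      to 2.\<close>
    have "(\<Sum>k<m. image_mset ((`) (h \<circ> f k)) (mset_set (edges T)))
        = image_mset ((`) h) (\<Sum>k<m. image_mset ((`) (f k)) (mset_set (edges T)))"
      by (simp add: image_mset_sum multiset.map_comp comp_def image_image)
    also have "\<dots> = repeat_mset 2 (mset_set (pairs W))"
      using inj_on_image_pairs[of h "{..<m}"] h image_pairs[OF h]
      by (simp add: sum_f image_mset_repeat_mset image_mset_mset_set bij_betw_def)
    finally show ?thesis
      using T bij_betw_trans[OF f h]
      by (intro exI[of _ "\<lambda>k. map_graph (h \<circ> f k) T"] decomposes_into_copies_map_graph) auto
  qed
  ultimately show ?thesis
    unfolding m_def by blast
qed

end
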